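(* Let $G$ be a finite directed graph on the vertex set $\{0,1,\dots,n\}$, possibly with multiple edges but without loops, with a fixed total order on the set of edges from $i$ to $j$ for all $i\neq j$. Let $\Pi(G)=\{\pi(T)\mid T\in\mathbb T_G\}$ be any proper set of tree orders for $G$. Then the map $\Theta=\Theta_{\Pi,G}$ is a bijection between the set $\mathcal T_G$ of spanning trees of $G$ rooted at $0$ and the set $\mathcal P_G$ of $G$-parking functions.
   Context: $G$-parking functions: $\mathcal P_G$ is the set of $n$-tuples $(b_1,\dots,b_n)$ of non-negative integers such that for every non-empty subset $U\subseteq\{1,\dots,n\}$ there is a vertex $j\in U$ for which the number of edges of $G$ going from $j$ to vertices outside of $U$ (counted with multiplicity; vertices outside $U$ include $0$) is greater than $b_j$. Subtrees: a subtree of $G$ rooted at $m$ is a subgraph $T$ of $G$ (a set of vertices and a set of edges) containing the vertex $m$ such that for every vertex $i$ of $T$ there is a unique directed path in $T$ from $i$ to $m$; that is, $T$ is a tree in the usual sense with each edge oriented towards $m$ (so $m$ has no outgoing edge in $T$ and every other vertex of $T$ has exactly one outgoing edge in $T$). It is a spanning tree if it contains all vertices of $G$. $\mathbb T_G$ is the set of all subtrees of $G$ rooted at $0$, and $\mathcal T_G\subseteq \mathbb T_G$ is the set of spanning trees of $G$ rooted at $0$. Trees using different parallel edges are different. Proper set of tree orders: for every $T\in\mathbb T_G$ let $\pi(T)$ be a total order on the vertices of $T$, written $<_{\pi(T)}$. The family $\Pi(G)=\{\pi(T)\mid T\in\mathbb T_G\}$ is a proper set of tree orders if for all $T\in\mathbb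 T_G$: (1) if $(j,i)$ is an edge of $T$ (directed from $j$ to $i$), then $i<_{\pi(T)}j$; (2) if $t$ is a subtree of $T$ rooted at $0$, then for all vertices $i,j$ of $t$, $i<_{\pi(t)}j$ if and only if $i<_{\pi(T)}j$. Induced order on edges: for $T\in\mathbb T_G$ and a vertex $j$ of $G$, $\pi(T)$ induces a total order, also written $<_{\pi(T)}$, on the edges of $G$ going from $j$ to vertices of $T$: an edge $(j,i)$ is smaller than an edge $(j,i')$ whenever $i<_{\pi(T)}i'$, and parallel edges are compared by the fixed order on them. The map $\Theta_{\Pi,G}$: for $T\in\mathcal T_G$ and $j\in\{1,\dots,n\}$, let $e_j$ be the edge of $T$ going out of $j$. Set $\Theta_{\Pi,G}(T)=(b_1,\dots,b_n)$, where $b_j$ is the number of edges $e$ of $G$ going out of $j$ such that $e<_{\pi(T)}e_j$. *)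

theory Defs
  imports "Graph_Theory.Graph_Theory" "HOL-Library.FuncSet"
begin

text \<open>
  Graphs are directed multigraphs \<^typ>\<open>(nat, 'e) pre_digraph\<close>, with \<open>{0..n}\<close> as
  set of vertices; parallel edges are different elements of \<open>arcs G\<close>.
  Tuples \<open>(b\<^sub>1, \<dots>, b\<^sub>n)\<close> are elements of \<open>{1..n} \<rightarrow>\<^sub>E UNIV\<close>.
\<close>

definition parking_functions :: "(nat, 'e) pre_digraph \<Rightarrow> nat \<Rightarrow> (nat \<Rightarrow> nat) set" where
  "parking_functions G n =
     {b \<in> {1..n} \<rightarrow>\<^sub>E UNIV.
        \<forall>U. U \<subseteq> {1..n} \<and> U \<noteq> {} \<longrightarrow>
          (\<exists>j\<in>U. card {e \<in> out_arcs G j. head G e \<notin> U} > b j)}"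

text \<open>
  A subgraph has the same incidence functions as \<open>G\<close>, so it is determined by its
  vertices and its edges. The unique directed path is stated with \<open>awalk\<close>, which allows
  vertices to be repeated: uniqueness among all walks excludes directed cycles, in
  particular those through \<open>m\<close>. With \<open>apath\<close> (no repeated vertices) the subgraph
  with edges \<open>m \<rightarrow> i\<close> and \<open>i \<rightarrow> m\<close> would pass as a tree rooted at \<open>m\<close>.
\<close>

definition rooted_subtree ::
    "('v, 'e) pre_digraph \<Rightarrow> 'v \<Rightarrow> ('v, 'e) pre_digraph \<Rightarrow> bool" where
  "rooted_subtree G m T \<longleftrightarrow>
     subgraph T G \<and> m \<in> verts T \<and> (\<forall>i \<in> verts T. \<exists>!p. pre_digraph.awalk T i p m)"

definition subtrees :: "(nat, 'e) pre_digraph \<Rightarrow> (nat, 'e) pre_digraph set" where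
  "subtrees G = {T. rooted_subtree G 0 T}"

definition spanning_trees :: "(nat, 'e) pre_digraph \<Rightarrow> (nat, 'e) pre_digraph set" where
  "spanning_trees G = {T \<in> subtrees G. spanning T G}"

lemma rooted_subtree_root_no_out_arc:
  assumes "rooted_subtree G m T"
  shows "out_arcs T m = {}"
proof (rule ccontr)
  assume "out_arcs T m \<noteq> {}"
  then obtain e where e: "e \<in> arcs T" "tail T e = m"
    by (metis all_not_in_conv in_out_arcs_conv)
  interpret wf_digraph T using assms by (auto simp: rooted_subtree_def subgraph_def)
  have h: "head T e \<in> verts T" using e by auto
  then obtain p where p: "awalk (head T e) p m"
    using assms by (auto simp: rooted_subtree_def)
  have m: "m \<in> verts T" using assms by (simp add: rooted_subtree_def)
  have "awalk m (e # p) m" "awalk m [] m"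
    using e p m by (auto simp: awalk_Cons_iff awalk_Nil_iff)
  then show False
    using assms m unfolding rooted_subtree_def by blast
qed

lemma rooted_subtree_unique_out_arc:
  assumes "rooted_subtree G m T" "j \<in> verts T" "j \<noteq> m"
  shows "\<exists>!e. e \<in> out_arcs T j"
proof -
  interpret wf_digraph T using assms by (auto simp: rooted_subtree_def subgraph_def)
  obtain p where p: "awalk j p m" and uniq: "\<And>q. awalk j q m \<Longrightarrow> q = p"
    using assms unfolding rooted_subtree_def by metis
  obtain e q where eq: "p = e # q"
    using p assms(3) by (cases p) (auto simp: awalk_Nil_iff)
  show ?thesis
  proof (rule ex1I[of _ e])
    show "e \<in> out_arcs T j" using p eq by (auto simp: awalk_Cons_iff)
  next
    fix f assume f: "f \<in> out_arcs T j"
    then have "head T f \<in> verts T" by auto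
    then obtain r where "awalk (head T f) r m"
      using assms by (auto simp: rooted_subtree_def)
    then have "awalk j (f # r) m" using f by (auto simp: awalk_Cons_iff)
    then show "f = e" using uniq eq by blast
  qed
qed

text \<open>
  Orders are given as reflexive relations, as in \<^const>\<open>linear_order_on\<close>;
  this is the associated strict order.
\<close>

definition less_in :: "'a rel \<Rightarrow> 'a \<Rightarrow> 'a \<Rightarrow> bool" where
  "less_in r x y \<longleftrightarrow> (x, y) \<in> r \<and> x \<noteq> y"

text \<open>\<open>\<pi>\<close> is only constrained on \<^term>\<open>subtrees G\<close>; its other values are irrelevant.\<close>

definition proper_tree_orders ::
    "(nat, 'e) pre_digraph \<Rightarrow> ((nat, 'e) pre_digraph \<Rightarrow> nat rel) \<Rightarrow> bool" where
  "proper_tree_orders G \<pi> \<longleftrightarrow>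
     (\<forall>T \<in> subtrees G.
        linear_order_on (verts T) (\<pi> T) \<and>
        (\<forall>e \<in> arcs T. less_in (\<pi> T) (head T e) (tail T e)) \<and>
        (\<forall>t \<in> subtrees T. \<forall>i \<in> verts t. \<forall>j \<in> verts t.
           less_in (\<pi> t) i j \<longleftrightarrow> less_in (\<pi> T) i j))"

text \<open>\<open>ord i j\<close> is the fixed order on the set of edges from \<open>i\<close> to \<open>j\<close>.\<close>

definition parallel_edge_orders ::
    "(nat, 'e) pre_digraph \<Rightarrow> (nat \<Rightarrow> nat \<Rightarrow> 'e rel) \<Rightarrow> bool" where
  "parallel_edge_orders G ord \<longleftrightarrow>
     (\<forall>i \<in> verts G. \<forall>j \<in> verts G. i \<noteq> j \<longrightarrow>
        linear_order_on {e \<in> arcs G. tail G e = i \<and> head G e = j} (ord i j))"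

text \<open>
  The order induced by \<open>\<pi> T\<close> on the edges of \<open>G\<close> from \<open>j\<close> to vertices of \<open>T\<close>
  (all edges of \<open>G\<close> from \<open>j\<close>, not only those of \<open>T\<close>).
\<close>

definition edge_less ::
    "(nat, 'e) pre_digraph \<Rightarrow> (nat \<Rightarrow> nat \<Rightarrow> 'e rel) \<Rightarrow> ((nat, 'e) pre_digraph \<Rightarrow> nat rel) \<Rightarrow>
     (nat, 'e) pre_digraph \<Rightarrow> nat \<Rightarrow> 'e \<Rightarrow> 'e \<Rightarrow> bool" where
  "edge_less G ord \<pi> T j e e' \<longleftrightarrow>
     e \<in> out_arcs G j \<and> head G e \<in> verts T \<and>
     e' \<in> out_arcs G j \<and> head G e' \<in> verts T \<and>
     (less_in (\<pi> T) (head G e) (head G e') \<or>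
      head G e = head G e' \<and> less_in (ord j (head G e)) e e')"

definition Theta ::
    "(nat, 'e) pre_digraph \<Rightarrow> nat \<Rightarrow> (nat \<Rightarrow> nat \<Rightarrow> 'e rel) \<Rightarrow>
     ((nat, 'e) pre_digraph \<Rightarrow> nat rel) \<Rightarrow> (nat, 'e) pre_digraph \<Rightarrow> nat \<Rightarrow> nat" where
  "Theta G n ord \<pi> T =
     (\<lambda>j\<in>{1..n}. card {e \<in> out_arcs G j. edge_less G ord \<pi> T j e (THE f. f \<in> out_arcs T j)})"

end

theory Submission
  imports Defs
begin

text \<open>
  Call the number of arcs leaving \<open>j\<close> that precede \<open>e\<close> the rank of the arc \<open>e\<close> leaving \<open>j\<close>, so
  that \<open>\<Theta>\<close> records the ranks of the arcs of a spanning tree. The whole proof rests on trees \<open>t\<close>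
  that are initial in a larger tree \<open>T\<close>: all vertices of \<open>t\<close> come before all other vertices of \<open>T\<close>.
  An arc that ends in \<open>t\<close> is preceded only by arcs that end in \<open>t\<close>, and properness says that
  they are ordered alike by \<open>\<pi> t\<close> and \<open>\<pi> T\<close>; hence its rank is the same in \<open>t\<close> and in \<open>T\<close>.

  The values of \<open>\<Theta>\<close> are parking functions: in a non-empty set \<open>U\<close> of vertices take the
  \<open>\<pi> T\<close>-least one \<open>j\<close>. The arc of \<open>T\<close> leaving \<open>j\<close> and all arcs that precede it end at vertices
  below \<open>j\<close>, thus outside of \<open>U\<close>.

  Injectivity: let \<open>T\<close> and \<open>T'\<close> have the same ranks and let \<open>t\<close> be a largest tree that is initial
  in both. If \<open>t\<close> is not spanning, let \<open>e\<close> be the arc of \<open>T\<close> leaving the least vertex of \<open>T\<close>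
  outside of \<open>t\<close>, and let \<open>f\<close> be the corresponding arc of \<open>T'\<close>. Both arcs end in \<open>t\<close>, so their
  ranks can be computed in \<open>t\<close>, and it follows that each of \<open>T\<close> and \<open>T'\<close> contains both arcs.
  Then \<open>t\<close> with \<open>e\<close> and \<open>f\<close> added is a subtree of both, so \<open>T\<close> and \<open>T'\<close> agree about the order of
  the two tails. These must therefore be equal, and \<open>t\<close> with \<open>e\<close> added is a larger tree that is
  initial in both.

  Surjectivity: given a parking function \<open>b\<close>, a tree is grown from the root. The frontier of \<open>t\<close>
  consists of the arcs that enter \<open>t\<close> from outside and have the rank prescribed by \<open>b\<close>; the
  parking condition for the complement of \<open>t\<close> says that it is non-empty unless \<open>t\<close> is spanning.
  Adding all of the frontier to \<open>t\<close> gives a tree, whose order selects the frontier arc with the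
  least tail; this arc is added to \<open>t\<close>. The invariant that makes the ranks in \<open>t\<close> final is that
  \<open>t\<close> is initial in \<open>t\<close> with any one arc of its frontier added.
\<close>

section \<open>Strict parts of linear orders and ranks\<close>

lemma less_in_irrefl: "\<not> less_in r x x"
  by (simp add: less_in_def)

lemma less_in_trans:
  assumes "linear_order_on A r" "less_in r x y" "less_in r y z"
  shows "less_in r x z"
  using assms unfolding less_in_def order_on_defs
  by (metis antisymD transD)

lemma less_in_asym:
  assumes "linear_order_on A r" "less_in r x y"
  shows "\<not> less_in r y x"
  using assms less_in_trans less_in_irrefl by metis

lemma less_in_total:
  assumes "linear_order_on A r" "x \<in> A" "y \<in> A" "x \<noteq> y"
  shows "less_in r x y \<or> less_in r y x"
  using assms unfolding less_in_def order_on_defs total_on_def by blast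

lemma less_in_least:
  assumes lin: "linear_order_on A r" and "finite C" "C \<noteq> {}" "C \<subseteq> A"
  obtains v where "v \<in> C" "\<And>x. x \<in> C \<Longrightarrow> x \<noteq> v \<Longrightarrow> less_in r v x"
proof -
  have "asymp_on C (less_in r)"
    using less_in_asym[OF lin] by (auto simp: asymp_on_def)
  moreover have "transp_on C (less_in r)"
    using less_in_trans[OF lin] by (auto simp: transp_on_def)
  ultimately obtain v where "v \<in> C" "\<forall>x\<in>C. x \<noteq> v \<longrightarrow> \<not> less_in r x v"
    using Finite_Set.bex_min_element[of C "less_in r"] assms by blast
  then show thesis
    using that less_in_total[OF lin] assms(4) by (metis subsetD)
qed

text \<open>
  The rank grows strictly along the order, so it is injective, and it takes \<open>card E\<close> values
  below \<open>card E\<close>.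
\<close>

lemma bij_betw_card_below:
  fixes R :: "'a \<Rightarrow> 'a \<Rightarrow> bool"
  assumes fin: "finite E"
    and irrefl: "\<And>x. \<not> R x x"
    and trans: "\<And>x y z. R x y \<Longrightarrow> R y z \<Longrightarrow> R x z"
    and total: "\<And>x y. x \<in> E \<Longrightarrow> y \<in> E \<Longrightarrow> x \<noteq> y \<Longrightarrow> R x y \<or> R y x"
  shows "bij_betw (\<lambda>e. card {f \<in> E. R f e}) E {..<card E}"
proof -
  let ?r = "\<lambda>e. card {f \<in> E. R f e}"
  have less: "?r x < ?r y" if "x \<in> E" "R x y" for x y
  proof (rule psubset_card_mono)
    show "finite {f \<in> E. R f y}" using fin by simp
    show "{f \<in> E. R f x} \<subset> {f \<in> E. R f y}"
      using that irrefl trans by blast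
  qed
  have inj: "inj_on ?r E"
  proof (rule inj_onI, rule ccontr)
    fix x y assume "x \<in> E" "y \<in> E" "?r x = ?r y" "x \<noteq> y"
    then show False using total[of x y] less[of x y] less[of y x] by auto
  qed
  have "?r e < card E" if "e \<in> E" for e
    using that irrefl fin by (intro psubset_card_mono) auto
  then have "?r ` E \<subseteq> {..<card E}" by auto
  moreover have "card (?r ` E) = card {..<card E}"
    using card_image[OF inj] by simp
  ultimately have "?r ` E = {..<card E}"
    by (intro card_subset_eq) auto
  with inj show ?thesis by (simp add: bij_betw_def)
qed

section \<open>Growing rooted subtrees by leaves\<close>

lemma rooted_subtree_wf: "rooted_subtree G m T \<Longrightarrow> wf_digraph T"
  by (simp add: rooted_subtree_def subgraph_def)

lemma rooted_subtree_subgraph: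
  assumes "rooted_subtree G m t" "rooted_subtree G m T"
    and "verts t \<subseteq> verts T" "arcs t \<subseteq> arcs T"
  shows "rooted_subtree T m t"
  using assms unfolding rooted_subtree_def subgraph_def compatible_def by simp

lemma rooted_subtree_singleton:
  assumes "wf_digraph G" "m \<in> verts G"
  shows "rooted_subtree G m (G\<lparr>verts := {m}, arcs := {}\<rparr>)"
proof -
  let ?t = "G\<lparr>verts := {m}, arcs := {}\<rparr>"
  have wf: "wf_digraph ?t" by unfold_locales auto
  have "pre_digraph.awalk ?t m p m \<longleftrightarrow> p = []" for p
    by (cases p) (auto simp: wf_digraph.awalk_simps[OF wf])
  with assms wf show ?thesis
    by (auto simp: rooted_subtree_def subgraph_def compatible_def)
qed

definition add_leaves :: "('v, 'e) pre_digraph \<Rightarrow> 'e set \<Rightarrow> ('v, 'e) pre_digraph" where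
  "add_leaves t F = t\<lparr>verts := verts t \<union> tail t ` F, arcs := arcs t \<union> F\<rparr>"

lemma add_leaves_simps [simp]:
  "verts (add_leaves t F) = verts t \<union> tail t ` F"
  "arcs (add_leaves t F) = arcs t \<union> F"
  "tail (add_leaves t F) = tail t"
  "head (add_leaves t F) = head t"
  by (simp_all add: add_leaves_def)

lemma rooted_subtree_add_leaves:
  assumes t: "rooted_subtree G m t" and F: "F \<subseteq> arcs G"
    and tails: "inj_on (tail G) F" "\<And>e. e \<in> F \<Longrightarrow> tail G e \<notin> verts t"
    and heads: "\<And>e. e \<in> F \<Longrightarrow> head G e \<in> verts t"
  shows "rooted_subtree G m (add_leaves t F)"
proof -
  let ?s = "add_leaves t F"
  interpret G: wf_digraph G using t by (auto simp: rooted_subtree_def subgraph_def)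
  interpret t: wf_digraph t by (rule rooted_subtree_wf[OF t])
  have eq: "tail t = tail G" "head t = head G"
    using t by (auto simp: rooted_subtree_def subgraph_def compatible_def)
  interpret s: wf_digraph ?s
    by unfold_locales (use eq heads t.head_in_verts t.tail_in_verts in auto)
  \<comment> \<open>A walk of the larger graph cannot leave \<open>t\<close>, as the new arcs start outside of \<open>t\<close>.\<close>
  have old: "s.awalk i p m \<longleftrightarrow> t.awalk i p m" if "i \<in> verts t" for i p
    using that
  proof (induction p arbitrary: i)
    case Nil
    then show ?case by (auto simp: s.awalk_simps t.awalk_simps)
  next
    case (Cons e p)
    then show ?case
      using tails(2) eq t.head_in_verts
      by (auto simp: s.awalk_simps t.awalk_simps)
  qed
  have new: "\<exists>!p. s.awalk (tail G e) p m" if e: "e \<in> F" for e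
  proof -
    obtain p where p: "t.awalk (head G e) p m" "\<And>q. t.awalk (head G e) q m \<Longrightarrow> q = p"
      using t heads[OF e] unfolding rooted_subtree_def by metis
    show ?thesis
    proof (rule ex1I)
      show "s.awalk (tail G e) (e # p) m"
        using e p(1) eq old heads[OF e] by (simp add: s.awalk_Cons_iff)
    next
      fix q assume q: "s.awalk (tail G e) q m"
      have "tail G e \<noteq> m"
        using t tails(2)[OF e] by (auto simp: rooted_subtree_def)
      with q obtain f r where f: "q = f # r" "f \<in> arcs t \<union> F" "tail G e = tail G f"
        "s.awalk (head G f) r m"
        by (cases q) (auto simp: s.awalk_simps eq)
      have "f \<notin> arcs t" using f(3) tails(2)[OF e] t.tail_in_verts eq(1) by metis
      with f(2) have "f \<in> F" by simp
      then have "f = e" using tails(1) f(3) e by (simp add: inj_on_eq_iff)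
      with f p(2) old heads[OF e] show "q = e # p" by auto
    qed
  qed
  have "subgraph ?s G"
    using t F eq s.wf_digraph
    by (auto simp: rooted_subtree_def subgraph_def compatible_def)
  moreover have "\<forall>i \<in> verts ?s. \<exists>!p. s.awalk i p m"
  proof
    fix i assume "i \<in> verts ?s"
    then consider "i \<in> verts t" | e where "e \<in> F" "i = tail G e" using eq by auto
    then show "\<exists>!p. s.awalk i p m"
    proof cases
      case 1
      then show ?thesis using t old by (simp add: rooted_subtree_def)
    next
      case 2
      then show ?thesis using new by simp
    qed
  qed
  moreover have "m \<in> verts ?s" using t by (simp add: rooted_subtree_def)
  ultimately show ?thesis unfolding rooted_subtree_def by blast
qed

section \<open>Ranks of arcs and initial subtrees\<close>

locale tree_ordered_digraph =
  fixes G :: "(nat, 'e) pre_digraph" and n :: nat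
    and ord :: "nat \<Rightarrow> nat \<Rightarrow> 'e rel"
    and \<pi> :: "(nat, 'e) pre_digraph \<Rightarrow> nat rel"
  assumes fin: "fin_digraph G" and loopfree: "loopfree_digraph G"
    and verts_G: "verts G = {0..n}"
    and parallel: "parallel_edge_orders G ord"
    and proper: "proper_tree_orders G \<pi>"
begin

sublocale fin_digraph G by (rule fin)

definition arcs_into :: "(nat, 'e) pre_digraph \<Rightarrow> nat \<Rightarrow> 'e set" where
  "arcs_into t j = {e \<in> out_arcs G j. head G e \<in> verts t}"

definition rank :: "(nat, 'e) pre_digraph \<Rightarrow> 'e \<Rightarrow> nat" where
  "rank t e = card {f \<in> out_arcs G (tail G e). edge_less G ord \<pi> t (tail G e) f e}"

definition initial :: "(nat, 'e) pre_digraph \<Rightarrow> (nat, 'e) pre_digraph \<Rightarrow> bool" where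
  "initial t T \<longleftrightarrow> t \<in> subtrees G \<and> T \<in> subtrees G \<and> verts t \<subseteq> verts T \<and> arcs t \<subseteq> arcs T \<and>
     (\<forall>x \<in> verts t. \<forall>y \<in> verts T - verts t. less_in (\<pi> T) x y)"

lemma subtreesD:
  assumes "t \<in> subtrees G"
  shows "verts t \<subseteq> {0..n}" "arcs t \<subseteq> arcs G" "tail t = tail G" "head t = head G"
    "0 \<in> verts t" "finite (verts t)" "linear_order_on (verts t) (\<pi> t)"
    "\<And>e. e \<in> arcs t \<Longrightarrow> tail G e \<in> verts t \<and> head G e \<in> verts t \<and> tail G e \<noteq> 0 \<and>
           less_in (\<pi> t) (head G e) (tail G e)"
proof -
  have t: "rooted_subtree G 0 t" using assms by (simp add: subtrees_def)
  interpret t: wf_digraph t by (rule rooted_subtree_wf[OF t])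
  show *: "verts t \<subseteq> {0..n}" "arcs t \<subseteq> arcs G" "tail t = tail G" "head t = head G"
    "0 \<in> verts t"
    using t verts_G by (auto simp: rooted_subtree_def subgraph_def compatible_def)
  show "finite (verts t)" by (rule finite_subset[OF *(1)]) simp
  show "linear_order_on (verts t) (\<pi> t)"
    using proper assms by (simp add: proper_tree_orders_def)
  fix e assume e: "e \<in> arcs t"
  have "out_arcs t 0 = {}" by (rule rooted_subtree_root_no_out_arc[OF t])
  then have "tail G e \<noteq> 0" using e *(3) by (auto simp: out_arcs_def)
  then show "tail G e \<in> verts t \<and> head G e \<in> verts t \<and> tail G e \<noteq> 0 \<and>
      less_in (\<pi> t) (head G e) (tail G e)"
    using e *(3,4) t.wellformed[OF e] proper assms by (auto simp: proper_tree_orders_def)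
qed

lemma less_in_subtree:
  assumes "t \<in> subtrees G" "T \<in> subtrees G" "verts t \<subseteq> verts T" "arcs t \<subseteq> arcs T"
    and "x \<in> verts t" "y \<in> verts t"
  shows "less_in (\<pi> t) x y \<longleftrightarrow> less_in (\<pi> T) x y"
proof -
  have "t \<in> subtrees T"
    using assms(1-4) rooted_subtree_subgraph by (auto simp: subtrees_def)
  then show ?thesis
    using proper assms(2,5,6) by (auto simp: proper_tree_orders_def)
qed

lemma linear_order_parallel:
  assumes "e \<in> out_arcs G j"
  shows "linear_order_on {f \<in> arcs G. tail G f = j \<and> head G f = head G e} (ord j (head G e))"
proof -
  have "j \<in> verts G" "head G e \<in> verts G" "j \<noteq> head G e"
    using assms wellformed loopfree_digraph.no_loops[OF loopfree] by auto
  then show ?thesis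
    using parallel by (simp add: parallel_edge_orders_def)
qed

lemma edge_less_trans:
  assumes t: "t \<in> subtrees G"
    and "edge_less G ord \<pi> t j e f" "edge_less G ord \<pi> t j f g"
  shows "edge_less G ord \<pi> t j e g"
proof -
  have e: "e \<in> out_arcs G j" using assms(2) by (simp add: edge_less_def)
  have "less_in (\<pi> t) (head G e) (head G g) \<or>
      head G e = head G g \<and> less_in (ord j (head G e)) e g"
    using assms(2,3) less_in_trans[OF linear_order_parallel[OF e], of e f g]
      less_in_trans[OF subtreesD(7)[OF t], of "head G e" "head G f" "head G g"]
    by (auto simp: edge_less_def)
  then show ?thesis using assms(2,3) by (simp add: edge_less_def)
qed

lemma edge_less_total:
  assumes t: "t \<in> subtrees G" and e: "e \<in> arcs_into t j" and f: "f \<in> arcs_into t j" "e \<noteq> f"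
  shows "edge_less G ord \<pi> t j e f \<or> edge_less G ord \<pi> t j f e"
proof (cases "head G e = head G f")
  case False
  then show ?thesis
    using less_in_total[OF subtreesD(7)[OF t]] e f
    unfolding edge_less_def arcs_into_def by blast
next
  case True
  have "e \<in> out_arcs G j" using e by (simp add: arcs_into_def)
  then have "less_in (ord j (head G e)) e f \<or> less_in (ord j (head G e)) f e"
    by (rule less_in_total[OF linear_order_parallel]) (use e f True in \<open>auto simp: arcs_into_def\<close>)
  then show ?thesis
    using True e f unfolding edge_less_def arcs_into_def by auto
qed

lemma bij_betw_rank:
  assumes t: "t \<in> subtrees G"
  shows "bij_betw (rank t) (arcs_into t j) {..<card (arcs_into t j)}"
proof -
  let ?R = "edge_less G ord \<pi> t j"
  have "finite (arcs_into t j)" by (simp add: arcs_into_def finite_out_arcs)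
  then have "bij_betw (\<lambda>e. card {f \<in> arcs_into t j. ?R f e})
      (arcs_into t j) {..<card (arcs_into t j)}"
    by (rule bij_betw_card_below)
       (auto simp: edge_less_def[of _ _ _ _ _ x x for x] less_in_irrefl
         intro: edge_less_trans[OF t] dest: edge_less_total[OF t])
  moreover have "rank t e = card {f \<in> arcs_into t j. ?R f e}" if "e \<in> arcs_into t j" for e
    using that by (auto simp: rank_def arcs_into_def edge_less_def intro!: arg_cong[where f=card])
  ultimately show ?thesis by (simp cong: bij_betw_cong)
qed

lemma rank_eqD:
  assumes "t \<in> subtrees G" "e \<in> arcs G" "f \<in> arcs G" "tail G e = tail G f"
    and "head G e \<in> verts t" "head G f \<in> verts t" "rank t e = rank t f"
  shows "e = f"
  using bij_betw_imp_inj_on[OF bij_betw_rank[OF assms(1)], of "tail G e"] assms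
  by (auto simp: inj_on_def arcs_into_def)

text \<open>An arc that precedes \<open>e\<close> ends at or below the head of \<open>e\<close> in \<open>\<pi> T\<close>, and hence in \<open>t\<close>.\<close>

lemma rank_initial:
  assumes "initial t T" "head G e \<in> verts t"
  shows "rank t e = rank T e"
proof -
  have t: "t \<in> subtrees G" and T: "T \<in> subtrees G" and sub: "verts t \<subseteq> verts T" "arcs t \<subseteq> arcs T"
    and less: "\<And>x y. x \<in> verts t \<Longrightarrow> y \<in> verts T \<Longrightarrow> y \<notin> verts t \<Longrightarrow> less_in (\<pi> T) x y"
    using assms(1) by (auto simp: initial_def)
  have below: "x \<in> verts t" if "x \<in> verts T" "less_in (\<pi> T) x (head G e)" for x
    using less[OF assms(2)] that less_in_asym[OF subtreesD(7)[OF T]] by metis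
  have "edge_less G ord \<pi> t (tail G e) f e \<longleftrightarrow> edge_less G ord \<pi> T (tail G e) f e" for f
    using less_in_subtree[OF t T sub _ assms(2)] below sub assms(2)
    unfolding edge_less_def by (metis subsetD)
  then show ?thesis by (simp add: rank_def)
qed

lemma spanning_treesD:
  assumes "T \<in> spanning_trees G"
  shows "T \<in> subtrees G" "verts T = {0..n}"
  using assms verts_G by (auto simp: spanning_trees_def spanning_def)

lemma spanning_treesI:
  assumes "T \<in> subtrees G" "verts T = {0..n}"
  shows "T \<in> spanning_trees G"
  using assms verts_G
  by (auto simp: spanning_trees_def spanning_def subtrees_def rooted_subtree_def)

lemma out_arc:
  assumes "T \<in> spanning_trees G" "j \<in> {1..n}"
  obtains e where "e \<in> arcs T" "tail G e = j" "Theta G n ord \<pi> T j = rank T e"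
proof -
  have T: "rooted_subtree G 0 T" "verts T = {0..n}" "tail T = tail G"
    using spanning_treesD[OF assms(1)] subtreesD(3) by (auto simp: subtrees_def)
  have ex1: "\<exists>!e. e \<in> out_arcs T j"
    using rooted_subtree_unique_out_arc[OF T(1)] T(2) assms(2) by simp
  then have "(THE e. e \<in> out_arcs T j) \<in> out_arcs T j" by (rule theI')
  then show thesis
    using that[of "THE e. e \<in> out_arcs T j"] T(3) assms(2)
    by (simp add: Theta_def rank_def)
qed

lemma Theta_tail:
  assumes "T \<in> spanning_trees G" "e \<in> arcs T"
  shows "Theta G n ord \<pi> T (tail G e) = rank T e"
proof -
  have T: "T \<in> subtrees G" "rooted_subtree G 0 T" "verts T = {0..n}"
    using spanning_treesD[OF assms(1)] by (auto simp: subtrees_def)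
  have j: "tail G e \<in> {1..n}" using subtreesD(8)[OF T(1) assms(2)] T(3) by auto
  then obtain f where f: "f \<in> arcs T" "tail G f = tail G e"
    "Theta G n ord \<pi> T (tail G e) = rank T f"
    using out_arc[OF assms(1)] by metis
  have "f = e"
    using rooted_subtree_unique_out_arc[OF T(2), of "tail G e"] T(3) j f assms(2)
      subtreesD(3)[OF T(1)] by auto
  with f show ?thesis by simp
qed

lemma add_leaves_subtree:
  assumes "t \<in> subtrees G" "F \<subseteq> arcs G" "inj_on (tail G) F"
    and "\<And>e. e \<in> F \<Longrightarrow> tail G e \<notin> verts t \<and> head G e \<in> verts t"
  shows "add_leaves t F \<in> subtrees G"
  using assms by (auto simp: subtrees_def intro!: rooted_subtree_add_leaves)

lemma singleton_subtree: "G\<lparr>verts := {0}, arcs := {}\<rparr> \<in> subtrees G"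
  using rooted_subtree_singleton[OF wf_digraph] verts_G by (simp add: subtrees_def)

text \<open>Along the path to the root the order decreases, so the root is least.\<close>

lemma initial_singleton:
  assumes T: "T \<in> subtrees G"
  shows "initial (G\<lparr>verts := {0}, arcs := {}\<rparr>) T"
proof -
  note lin = subtreesD(7)[OF T]
  have "less_in (\<pi> T) 0 y" if "y \<in> verts T" "y \<noteq> 0" for y
  proof -
    obtain v where v: "v \<in> verts T" "\<And>x. x \<in> verts T \<Longrightarrow> x \<noteq> v \<Longrightarrow> less_in (\<pi> T) v x"
      using less_in_least[OF lin subtreesD(6)[OF T]] subtreesD(5)[OF T] by (metis empty_iff order_refl)
    have "v = 0"
    proof (rule ccontr)
      assume "v \<noteq> 0"
      then obtain e where "e \<in> arcs T" "tail G e = v"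
        using rooted_subtree_unique_out_arc[of G 0 T v] T v(1) subtreesD(3)[OF T]
        by (auto simp: subtrees_def)
      then show False
        using subtreesD(8)[OF T] v(2) less_in_asym[OF lin] less_in_irrefl by metis
    qed
    with v(2) that show ?thesis by metis
  qed
  then show ?thesis
    using singleton_subtree T subtreesD(5)[OF T] by (simp add: initial_def)
qed

lemma card_verts_subtree_le: "t \<in> subtrees G \<Longrightarrow> card (verts t) \<le> Suc n"
  using card_mono[of "{0..n}" "verts t"] subtreesD(1)[of t] by simp

section \<open>The values are parking functions\<close>

lemma Theta_parking:
  assumes T: "T \<in> spanning_trees G"
  shows "Theta G n ord \<pi> T \<in> parking_functions G n"
proof -
  note T' = spanning_treesD[OF T]
  have "\<exists>j\<in>U. Theta G n ord \<pi> T j < card {e \<in> out_arcs G j. head G e \<notin> U}"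
    if U: "U \<subseteq> {1..n}" "U \<noteq> {}" for U
  proof -
    have UT: "U \<subseteq> verts T" using U T'(2) by auto
    obtain j where j: "j \<in> U" "\<And>x. x \<in> U \<Longrightarrow> x \<noteq> j \<Longrightarrow> less_in (\<pi> T) j x"
      using less_in_least[OF subtreesD(7)[OF T'(1)] finite_subset[OF U(1)] U(2) UT] by auto
    have out: "x \<notin> U" if "less_in (\<pi> T) x j" for x
      using j(2) that less_in_asym[OF subtreesD(7)[OF T'(1)]] less_in_irrefl by metis
    obtain e where e: "e \<in> arcs T" "tail G e = j" "Theta G n ord \<pi> T j = rank T e"
      using out_arc[OF T] j(1) U(1) by (metis subsetD)
    have he: "less_in (\<pi> T) (head G e) j" using subtreesD(8)[OF T'(1) e(1)] e(2) by simp
    have "rank T e < card {e \<in> out_arcs G j. head G e \<notin> U}"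
      unfolding rank_def
    proof (rule psubset_card_mono)
      show "finite {e \<in> out_arcs G j. head G e \<notin> U}" by simp
      have "head G f \<notin> U" if "edge_less G ord \<pi> T j f e" for f
        using that out he less_in_trans[OF subtreesD(7)[OF T'(1)] _ he]
        unfolding edge_less_def by metis
      moreover have "\<not> edge_less G ord \<pi> T j e e"
        by (simp add: edge_less_def less_in_irrefl)
      moreover have "e \<in> out_arcs G j" "head G e \<notin> U"
        using e subtreesD(2)[OF T'(1)] out[OF he] by auto
      ultimately show "{f \<in> out_arcs G (tail G e). edge_less G ord \<pi> T (tail G e) f e}
          \<subset> {e \<in> out_arcs G j. head G e \<notin> U}"
        using e(2) by blast
    qed
    then show ?thesis using e(3) j(1) by (intro bexI[of _ j]) simp_all
  qed
  moreover have "Theta G n ord \<pi> T \<in> {1..n} \<rightarrow>\<^sub>E UNIV" by (simp add: Theta_def)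
  ultimately show ?thesis by (simp add: parking_functions_def)
qed

section \<open>Injectivity\<close>

lemma initial_add_least:
  assumes t: "initial t T" and e: "e \<in> arcs T" "tail G e \<notin> verts t" "head G e \<in> verts t"
    and least: "\<And>x. x \<in> verts T \<Longrightarrow> x \<notin> verts t \<Longrightarrow> x \<noteq> tail G e \<Longrightarrow> less_in (\<pi> T) (tail G e) x"
  shows "initial (add_leaves t {e}) T"
proof -
  have tT: "t \<in> subtrees G" "T \<in> subtrees G" using t by (auto simp: initial_def)
  have "add_leaves t {e} \<in> subtrees G"
    using e subtreesD(2)[OF tT(2)] by (intro add_leaves_subtree[OF tT(1)]) auto
  then show ?thesis
    using t e least subtreesD(8)[OF tT(2) e(1)] subtreesD(3)[OF tT(1)]
    by (auto simp: initial_def)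
qed

lemma least_outside:
  assumes t: "initial t T" and T: "T \<in> spanning_trees G" and ne: "verts t \<noteq> {0..n}"
  obtains e where "e \<in> arcs T" "tail G e \<notin> verts t" "head G e \<in> verts t"
    "\<And>x. x \<in> verts T \<Longrightarrow> x \<notin> verts t \<Longrightarrow> x \<noteq> tail G e \<Longrightarrow> less_in (\<pi> T) (tail G e) x"
proof -
  note T' = spanning_treesD[OF T]
  have tT: "t \<in> subtrees G" using t by (auto simp: initial_def)
  have "verts T - verts t \<noteq> {}" using subtreesD(1)[OF tT] T'(2) ne by auto
  then obtain v where v: "v \<in> verts T - verts t"
    "\<And>x. x \<in> verts T - verts t \<Longrightarrow> x \<noteq> v \<Longrightarrow> less_in (\<pi> T) v x"
    using less_in_least[OF subtreesD(7)[OF T'(1)], of "verts T - verts t"] subtreesD(6)[OF T'(1)]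
    by (metis Diff_subset finite_Diff)
  have "v \<noteq> 0" using v(1) subtreesD(5)[OF tT] by (metis DiffD2)
  then have "v \<in> {1..n}" using v(1) T'(2) by (simp add: Suc_le_eq)
  then obtain e where e: "e \<in> arcs T" "tail G e = v" using out_arc[OF T] by metis
  have "head G e \<in> verts t"
    using subtreesD(8)[OF T'(1) e(1)] e(2) v(2) less_in_asym[OF subtreesD(7)[OF T'(1)]]
      less_in_irrefl by (metis DiffI)
  then show thesis using that[OF e(1)] e(2) v by auto
qed

text \<open>
  Since \<open>f\<close> ends in \<open>t\<close>, its rank is the same in \<open>T'\<close>, in \<open>t\<close> and in \<open>T\<close>. By the equality of
  the values of \<open>\<Theta>\<close> this is also the rank in \<open>T\<close> of the arc of \<open>T\<close> that leaves the tail of \<open>f\<close>,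
  and ranks separate the arcs that leave a vertex.
\<close>

lemma arc_in_both:
  assumes T: "T \<in> spanning_trees G" and T': "T' \<in> spanning_trees G"
    and eq: "Theta G n ord \<pi> T = Theta G n ord \<pi> T'"
    and t: "initial t T" "initial t T'"
    and f: "f \<in> arcs T'" "head G f \<in> verts t"
  shows "f \<in> arcs T"
proof -
  note T1 = spanning_treesD[OF T] and T2 = spanning_treesD[OF T']
  have "tail G f \<in> {1..n}" using subtreesD(8)[OF T2(1) f(1)] T2(2) by auto
  then obtain g where g: "g \<in> arcs T" "tail G g = tail G f"
    "Theta G n ord \<pi> T (tail G f) = rank T g"
    using out_arc[OF T] by metis
  have "rank T f = rank T' f" using rank_initial t f(2) by metis
  also have "\<dots> = rank T g" using Theta_tail[OF T' f(1)] eq g(3) by simp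
  finally have "f = g"
    using rank_eqD[OF T1(1), of f g] g f(1) subtreesD(2)[OF T1(1)] subtreesD(2)[OF T2(1)]
      subtreesD(8)[OF T1(1) g(1)] subtreesD(8)[OF T2(1) f(1)] T1(2) T2(2) by auto
  with g show ?thesis by simp
qed

lemma spanning_initial_eq:
  assumes T: "T \<in> spanning_trees G" and t: "initial t T" "verts t = {0..n}"
  shows "t = T"
proof -
  note T' = spanning_treesD[OF T]
  have t': "t \<in> subtrees G" "arcs t \<subseteq> arcs T" using t by (auto simp: initial_def)
  note tt = spanning_treesI[OF t'(1) t(2)]
  have "e \<in> arcs t" if e: "e \<in> arcs T" for e
  proof -
    have j: "tail G e \<in> {1..n}" using subtreesD(8)[OF T'(1) e] T'(2) by auto
    obtain f where f: "f \<in> arcs t" "tail G f = tail G e" using out_arc[OF tt j] by metis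
    have "f = e"
      using rooted_subtree_unique_out_arc[of G 0 T "tail G e"] T' j f t'(2) e subtreesD(3)[OF T'(1)]
      by (auto simp: subtrees_def)
    with f show ?thesis by simp
  qed
  then show ?thesis
    using t' t(2) T'(2) subtreesD(3,4)[OF t'(1)] subtreesD(3,4)[OF T'(1)]
    by (intro pre_digraph.equality) auto
qed

lemma inj_on_Theta: "inj_on (Theta G n ord \<pi>) (spanning_trees G)"
proof (rule inj_onI)
  fix T T' assume T: "T \<in> spanning_trees G" and T': "T' \<in> spanning_trees G"
    and eq: "Theta G n ord \<pi> T = Theta G n ord \<pi> T'"
  note T1 = spanning_treesD[OF T] and T2 = spanning_treesD[OF T']
  let ?P = "\<lambda>t. initial t T \<and> initial t T'"
  have "?P (G\<lparr>verts := {0}, arcs := {}\<rparr>)"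
    using initial_singleton T1(1) T2(1) by blast
  moreover have "\<forall>t. ?P t \<longrightarrow> card (verts t) < Suc (Suc n)"
    using card_verts_subtree_le by (force simp: initial_def)
  ultimately obtain t where t: "initial t T" "initial t T'"
    and max: "\<And>s. ?P s \<Longrightarrow> card (verts s) \<le> card (verts t)"
    using ex_has_greatest_nat[of ?P _ "\<lambda>t. card (verts t)" "Suc (Suc n)"] by blast
  have tG: "t \<in> subtrees G" using t by (simp add: initial_def)
  have "verts t = {0..n}"
  proof (rule ccontr)
    assume ne: "verts t \<noteq> {0..n}"
    obtain e where e: "e \<in> arcs T" "tail G e \<notin> verts t" "head G e \<in> verts t"
      and e_least: "\<And>x. x \<in> verts T \<Longrightarrow> x \<notin> verts t \<Longrightarrow> x \<noteq> tail G e \<Longrightarrow> less_in (\<pi> T) (tail G e) x"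
      using least_outside[OF t(1) T ne] by blast
    obtain f where f: "f \<in> arcs T'" "tail G f \<notin> verts t" "head G f \<in> verts t"
      and f_least: "\<And>x. x \<in> verts T' \<Longrightarrow> x \<notin> verts t \<Longrightarrow> x \<noteq> tail G f \<Longrightarrow> less_in (\<pi> T') (tail G f) x"
      using least_outside[OF t(2) T' ne] by blast
    have fT: "f \<in> arcs T" using arc_in_both[OF T T' eq t f(1,3)] .
    have eT': "e \<in> arcs T'" using arc_in_both[OF T' T eq[symmetric] t(2,1) e(1,3)] .
    have eG: "e \<in> arcs G" and fG: "f \<in> arcs G"
      using e(1) fT subtreesD(2)[OF T1(1)] by auto
    have tails: "tail G e = tail G f"
    proof (rule ccontr)
      assume neq: "tail G e \<noteq> tail G f"
      let ?s = "add_leaves t {e, f}"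
      have s: "?s \<in> subtrees G"
        using e f eG fG neq by (intro add_leaves_subtree[OF tG]) auto
      have in_s: "tail G e \<in> verts ?s" "tail G f \<in> verts ?s"
        using subtreesD(3)[OF tG] by auto
      have V: "verts ?s \<subseteq> {0..n}" using subtreesD(1)[OF s] .
      have "less_in (\<pi> T) (tail G e) (tail G f)"
        using e_least f(2) neq V in_s T1(2) by auto
      then have "less_in (\<pi> ?s) (tail G e) (tail G f)"
        using less_in_subtree[OF s T1(1) _ _ in_s] V T1(2) t(1) e(1) fT by (auto simp: initial_def)
      moreover have "less_in (\<pi> T') (tail G f) (tail G e)"
        using f_least e(2) neq V in_s T2(2) by auto
      then have "less_in (\<pi> ?s) (tail G f) (tail G e)"
        using less_in_subtree[OF s T2(1) _ _ in_s(2,1)] V T2(2) t(2) f(1) eT' by (auto simp: initial_def)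
      ultimately show False using less_in_asym[OF subtreesD(7)[OF s]] by blast
    qed
    have "?P (add_leaves t {e})"
      using initial_add_least[OF t(1) e e_least] initial_add_least[OF t(2) eT' e(2,3)] f_least tails
      by auto
    from max[OF this] show False
      using e(2) subtreesD(3,6)[OF tG] by simp
  qed
  then show "T = T'" using spanning_initial_eq[OF T t(1)] spanning_initial_eq[OF T' t(2)] by simp
qed

section \<open>Surjectivity\<close>

definition frontier :: "(nat \<Rightarrow> nat) \<Rightarrow> (nat, 'e) pre_digraph \<Rightarrow> 'e set" where
  "frontier b t = {e \<in> arcs G. tail G e \<notin> verts t \<and> head G e \<in> verts t \<and> rank t e = b (tail G e)}"

text \<open>
  The last conjunct is what makes a step of the construction possible: after one frontier arc is
  added, its tail is the greatest vertex, so no rank that was computed before can change.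
\<close>

definition partial_inverse :: "(nat \<Rightarrow> nat) \<Rightarrow> (nat, 'e) pre_digraph \<Rightarrow> bool" where
  "partial_inverse b t \<longleftrightarrow> t \<in> subtrees G \<and> (\<forall>e \<in> arcs t. rank t e = b (tail G e)) \<and>
     (\<forall>e \<in> frontier b t. initial t (add_leaves t {e}))"

lemma frontier_nonempty:
  assumes b: "b \<in> parking_functions G n" and t: "t \<in> subtrees G" and ne: "verts t \<noteq> {0..n}"
  shows "frontier b t \<noteq> {}"
proof -
  let ?U = "{0..n} - verts t"
  have "?U \<subseteq> {1..n}"
  proof
    fix x assume x: "x \<in> ?U"
    then have "x \<noteq> 0" using subtreesD(5)[OF t] by (metis DiffD2)
    with x show "x \<in> {1..n}" by simp
  qed
  moreover have "?U \<noteq> {}" using subtreesD(1)[OF t] ne by auto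
  ultimately obtain j where j: "j \<in> ?U" "b j < card {e \<in> out_arcs G j. head G e \<notin> ?U}"
    using b unfolding parking_functions_def mem_Collect_eq by blast
  have "{e \<in> out_arcs G j. head G e \<notin> ?U} = arcs_into t j"
    using head_in_verts verts_G subtreesD(1)[OF t] by (auto simp: arcs_into_def)
  with j(2) have "b j \<in> rank t ` arcs_into t j"
    using bij_betw_imp_surj_on[OF bij_betw_rank[OF t, of j]] by auto
  then show ?thesis using j(1) by (auto simp: frontier_def arcs_into_def)
qed

text \<open>Ranks are injective, so each vertex outside of \<open>t\<close> is the tail of at most one frontier arc.\<close>

lemma add_frontier_subtree:
  assumes t: "t \<in> subtrees G" and F: "F \<subseteq> frontier b t"
  shows "add_leaves t F \<in> subtrees G"
proof (rule add_leaves_subtree[OF t])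
  show "inj_on (tail G) F"
    using F rank_eqD[OF t] by (auto simp: inj_on_def frontier_def subset_iff)
qed (use F in \<open>auto simp: frontier_def\<close>)

text \<open>
  Let \<open>e\<close> be the frontier arc with the least tail in the tree \<open>s\<close> that contains the whole frontier.
  The point is that the tail of \<open>e\<close> precedes the tail of each arc \<open>g\<close> of the new frontier: either
  \<open>g\<close> ends at the tail of \<open>e\<close>, or \<open>g\<close> already was in the old frontier and the choice of \<open>e\<close>
  decides, since properness carries the order of \<open>s\<close> over to the tree obtained from \<open>t\<close> by adding
  only \<open>e\<close> and \<open>g\<close>.
\<close>

lemma partial_inverse_step:
  assumes inv: "partial_inverse b t" and ne: "frontier b t \<noteq> {}"
  obtains e where "e \<in> frontier b t" "partial_inverse b (add_leaves t {e})"
proof -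
  let ?F = "frontier b t"
  let ?s = "add_leaves t ?F"
  have t: "t \<in> subtrees G" and rank_t: "\<And>e. e \<in> arcs t \<Longrightarrow> rank t e = b (tail G e)"
    and init: "\<And>e. e \<in> ?F \<Longrightarrow> initial t (add_leaves t {e})"
    using inv by (auto simp: partial_inverse_def)
  have tail_t [simp]: "tail t = tail G" by (rule subtreesD(3)[OF t])
  have s: "?s \<in> subtrees G" by (rule add_frontier_subtree[OF t order_refl])
  have "tail G ` ?F \<subseteq> verts ?s" "finite (tail G ` ?F)"
    by (auto simp: frontier_def)
  then obtain v where v: "v \<in> tail G ` ?F"
    "\<And>x. x \<in> tail G ` ?F \<Longrightarrow> x \<noteq> v \<Longrightarrow> less_in (\<pi> ?s) v x"
    using less_in_least[OF subtreesD(7)[OF s], of "tail G ` ?F"] ne by auto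
  then obtain e where e: "e \<in> ?F"
    and least: "\<And>g. g \<in> ?F \<Longrightarrow> tail G g \<noteq> tail G e \<Longrightarrow> less_in (\<pi> ?s) (tail G e) (tail G g)"
    by blast
  let ?t = "add_leaves t {e}"
  have t': "?t \<in> subtrees G" using add_frontier_subtree[OF t] e by blast
  note init_e = init[OF e]
  have e': "e \<in> arcs G" "tail G e \<notin> verts t" "head G e \<in> verts t" "rank t e = b (tail G e)"
    using e by (auto simp: frontier_def)
  have "rank ?t g = b (tail G g)" if "g \<in> arcs ?t" for g
  proof -
    have "head G g \<in> verts t" "rank t g = b (tail G g)"
      using that e' rank_t subtreesD(8)[OF t] by auto
    then show ?thesis using rank_initial[OF init_e] by simp
  qed
  moreover have "initial ?t (add_leaves ?t {g})" if g: "g \<in> frontier b ?t" for g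
  proof -
    let ?u = "add_leaves ?t {g}"
    have u: "?u \<in> subtrees G" using add_frontier_subtree[OF t'] g by blast
    have g': "g \<in> arcs G" "tail G g \<notin> verts ?t" "head G g \<in> verts ?t" "rank ?t g = b (tail G g)"
      using g by (auto simp: frontier_def)
    have less: "less_in (\<pi> ?u) (tail G e) (tail G g)"
    proof (cases "head G g = tail G e")
      case True
      then show ?thesis using subtreesD(8)[OF u, of g] by simp
    next
      \<comment> \<open>Then \<open>g\<close> was in the frontier already when \<open>e\<close> was selected.\<close>
      case False
      then have "head G g \<in> verts t" using g'(3) by simp
      then have gF: "g \<in> ?F"
        using g' rank_initial[OF init_e] by (simp add: frontier_def)
      then have "less_in (\<pi> ?s) (tail G e) (tail G g)"
        using least g'(2) by auto
      moreover have "less_in (\<pi> ?u) (tail G e) (tail G g) \<longleftrightarrow> less_in (\<pi> ?s) (tail G e) (tail G g)"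
        by (rule less_in_subtree[OF u s]) (use e gF in auto)
      ultimately show ?thesis by simp
    qed
    have "less_in (\<pi> ?u) x (tail G g)" if x: "x \<in> verts t" for x
    proof -
      have "less_in (\<pi> ?t) x (tail G e)"
        using init_e x e'(2) by (simp add: initial_def)
      then have "less_in (\<pi> ?u) x (tail G e)"
        using less_in_subtree[OF t' u, of x "tail G e"] x by auto
      then show ?thesis using less less_in_trans[OF subtreesD(7)[OF u]] by blast
    qed
    with less show ?thesis using t' u by (auto simp: initial_def)
  qed
  ultimately show thesis using that[OF e] t' by (auto simp: partial_inverse_def)
qed

lemma Theta_surj:
  assumes b: "b \<in> parking_functions G n"
  shows "\<exists>T \<in> spanning_trees G. Theta G n ord \<pi> T = b"
proof -
  let ?z = "G\<lparr>verts := {0}, arcs := {}\<rparr>"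
  have "partial_inverse b ?z"
    using singleton_subtree initial_singleton add_frontier_subtree[OF singleton_subtree]
    by (auto simp: partial_inverse_def)
  moreover have "\<forall>t. partial_inverse b t \<longrightarrow> card (verts t) < Suc (Suc n)"
    using card_verts_subtree_le by (force simp: partial_inverse_def)
  ultimately obtain t where t: "partial_inverse b t"
    and max: "\<And>s. partial_inverse b s \<Longrightarrow> card (verts s) \<le> card (verts t)"
    using ex_has_greatest_nat[of "partial_inverse b" _ "\<lambda>t. card (verts t)" "Suc (Suc n)"] by blast
  have tG: "t \<in> subtrees G" using t by (simp add: partial_inverse_def)
  have "verts t = {0..n}"
  proof (rule ccontr)
    assume "verts t \<noteq> {0..n}"
    then obtain e where "e \<in> frontier b t" "partial_inverse b (add_leaves t {e})"
      using partial_inverse_step[OF t frontier_nonempty[OF b tG]] by metis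
    then show False
      using max[of "add_leaves t {e}"] subtreesD(3,6)[OF tG] by (simp add: frontier_def)
  qed
  then have T: "t \<in> spanning_trees G" by (rule spanning_treesI[OF tG])
  have "Theta G n ord \<pi> t j = b j" for j
  proof (cases "j \<in> {1..n}")
    case True
    then show ?thesis using out_arc[OF T True] t by (metis partial_inverse_def)
  next
    case False
    then show ?thesis using b by (auto simp: Theta_def parking_functions_def PiE_def extensional_def)
  qed
  with T show ?thesis by blast
qed

end

section \<open>The bijection\<close>

theorem theorem2p1:
  fixes G :: "(nat, 'e) pre_digraph" and n :: nat
    and ord :: "nat \<Rightarrow> nat \<Rightarrow> 'e rel"
    and \<pi> :: "(nat, 'e) pre_digraph \<Rightarrow> nat rel"
  assumes "fin_digraph G" and "loopfree_digraph G" and "verts G = {0..n}"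
    and "parallel_edge_orders G ord"
    and "proper_tree_orders G \<pi>"
  shows "bij_betw (Theta G n ord \<pi>) (spanning_trees G) (parking_functions G n)"
proof -
  interpret tree_ordered_digraph G n ord \<pi>
    by (rule tree_ordered_digraph.intro) (fact assms)+
  show ?thesis
    using inj_on_Theta Theta_parking Theta_surj unfolding bij_betw_def by blast
qed

end
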